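(* Let $0<q<1$ and fix $\alpha>-1$, $c>0$, $k\in\mathbb{Z}$. Then, for each $x\in\mathbb{R}$, there is the pointwise limit $$\lim_{r\to\infty}\widetilde P_{r-k}(q^{\alpha+1}x;q^\alpha,0,-cq^{-r-1};q)=\mathcal{J}^c_{\alpha,k}(x;q),$$ where $r$ runs through the integers $r\ge k$. Furthermore, if $M>0$, then for all real $x$ with $|x|\le M$ and all $r=k,k+1,\ldots$, both $$\bigl|\widetilde P_{r-k}(q^{\alpha+1}x;q^\alpha,0,-cq^{-r-1};q)\bigr|\quad\text{and}\quad\bigl|\mathcal{J}^c_{\alpha,k}(x;q)\bigr|$$ are less than or equal to $${}_1\varphi_1\left({-M^{-1}\atop q^{\alpha+1}};q,\frac{-q^{\alpha+k+2}M}{c}\right).$$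
   Context: Notation: $(a;q)_n=\prod_{i=0}^{n-1}(1-aq^i)$, $(a_1,\dots,a_m;q)_n=\prod_j (a_j;q)_n$, and $${}_1\varphi_1\left({a\atop b};q,z\right)=\sum_{j=0}^\infty\frac{(a;q)_j}{(b;q)_j(q;q)_j}(-1)^jq^{j(j-1)/2}z^j,\qquad {}_2\varphi_1\left({a,b\atop d};q,z\right)=\sum_{j=0}^\infty\frac{(a,b;q)_j}{(d,q;q)_j}z^j,$$ $${}_3\varphi_2\left({a_1,a_2,a_3\atop b_1,b_2};q,z\right)=\sum_{j=0}^\infty\frac{(a_1,a_2,a_3;q)_j}{(b_1,b_2,q;q)_j}z^j .$$ Big $q$-Jacobi polynomials: for $0<a<q^{-1}$, $b>-q^{-1}$, $c>0$, $n\in\mathbb{Z}_{\ge0}$, $x\in\mathbb{R}$, $$P_n(x;a,b,-c;q)={}_3\varphi_2\left({q^{-n},abq^{n+1},x\atop aq,-cq};q,q\right).$$ For $b=0$ the renormalized polynomials are $$\widetilde P_n(x;a,0,-c;q)=(-c^{-1}q^{-n};q)_n\,P_n(x;a,0,-c;q)={}_2\varphi_1\left({q^{-n},aq/x\atop aq};q,-x/c\right).$$ Big $q$-Bessel functions: for $\alpha>-1$, $c>0$, $k\in\mathbb{Z}$, $x\in\mathbb{R}$, $$\mathcal{J}^c_{\alpha,k}(x;q)={}_1\varphi_1\left({x^{-1}\atop q^{\alpha+1}};q,-c^{-1}xq^{k+\alpha+2}\right).$$ In these series the products $(x^{-1};q)_j\,x^j$ are read as $\prod_{i=0}^{j-1}(x-q^i)$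 (and similarly $(aq/x;q)_jx^j=\prod_{i=0}^{j-1}(x-aq^{i+1})$), so that the expressions also make sense at $x=0$. *)

theory Defs
  imports "HOL-Analysis.Analysis"
begin

definition qpoch :: "real \<Rightarrow> real \<Rightarrow> nat \<Rightarrow> real" where
  "qpoch a q n = (\<Prod>i<n. 1 - a * q ^ i)"

definition phi11 :: "real \<Rightarrow> real \<Rightarrow> real \<Rightarrow> real \<Rightarrow> real" where
  "phi11 a b q z =
     (\<Sum>j. qpoch a q j / (qpoch b q j * qpoch q q j)
           * (-1) ^ j * q ^ (j * (j - 1) div 2) * z ^ j)"

definition phi32 ::
  "real \<Rightarrow> real \<Rightarrow> real \<Rightarrow> real \<Rightarrow> real \<Rightarrow> real \<Rightarrow> real \<Rightarrow> real" where
  "phi32 a1 a2 a3 b1 b2 q z =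
     (\<Sum>j. (qpoch a1 q j * qpoch a2 q j * qpoch a3 q j)
           / (qpoch b1 q j * qpoch b2 q j * qpoch q q j) * z ^ j)"

(* big_q_Jacobi n x a b c q is P_n(x; a, b, -c; q): the sign of the last
   parameter is part of the definition, so the argument c is positive. *)
definition big_q_Jacobi ::
  "nat \<Rightarrow> real \<Rightarrow> real \<Rightarrow> real \<Rightarrow> real \<Rightarrow> real \<Rightarrow> real" where
  "big_q_Jacobi n x a b c q =
     phi32 (q powi (- int n)) (a * b * q ^ (n + 1)) x (a * q) (- c * q) q q"

(* The renormalized polynomial of parameters (a, 0, -c), again with c positive. *)
definition big_q_Jacobi_tilde ::
  "nat \<Rightarrow> real \<Rightarrow> real \<Rightarrow> real \<Rightarrow> real \<Rightarrow> real" where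
  "big_q_Jacobi_tilde n x a c q =
     qpoch (- inverse c * q powi (- int n)) q n * big_q_Jacobi n x a 0 c q"

(* The series phi11 (1/x) (q powr (\<alpha> + 1)) q (- x q^(k + \<alpha> + 2) / c), in which
   the factors (1/x; q)_j x^j are read as the product of the x - q^i for i < j,
   so that x = 0 is allowed; see big_q_Bessel_eq_phi11. *)
definition big_q_Bessel ::
  "real \<Rightarrow> real \<Rightarrow> int \<Rightarrow> real \<Rightarrow> real \<Rightarrow> real" where
  "big_q_Bessel c \<alpha> k x q =
     (\<Sum>j. (\<Prod>i<j. x - q ^ i) / (qpoch (q powr (\<alpha> + 1)) q j * qpoch q q j)
           * (-1) ^ j * q ^ (j * (j - 1) div 2)
           * (- inverse c * q powr (of_int k + \<alpha> + 2)) ^ j)"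

lemma big_q_Bessel_eq_phi11:
  assumes "x \<noteq> 0"
  shows "big_q_Bessel c \<alpha> k x q =
    phi11 (inverse x) (q powr (\<alpha> + 1)) q (- inverse c * x * q powr (of_int k + \<alpha> + 2))"
proof -
  have prod: "(\<Prod>i<j. x - q ^ i) = qpoch (inverse x) q j * x ^ j" for j
  proof (induction j)
    case (Suc j)
    have "x - q ^ j = (1 - inverse x * q ^ j) * x"
      using assms by (simp add: left_diff_distrib)
    with Suc show ?case
      by (simp add: qpoch_def)
  qed (simp add: qpoch_def)
  have pow: "(- inverse c * x * y) ^ j = x ^ j * (- inverse c * y) ^ j" for y :: real and j
    by (simp add: mult.left_commute mult.assoc flip: power_mult_distrib)
  show ?thesis
    unfolding big_q_Bessel_def phi11_def prod pow
    by (simp add: mult_ac)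
qed

end

theory Submission
  imports Defs
begin

text \<open>
  Applying the \<open>q\<close>-Chu--Vandermonde sum inside the \<open>\<^sub>2\<phi>\<^sub>1\<close> series and exchanging summations, the
  inner sum becomes a finite \<open>q\<close>-binomial sum, which turns the renormalized \<open>\<^sub>3\<phi>\<^sub>2\<close> into the \<open>\<^sub>2\<phi>\<^sub>1\<close>.
  In the \<open>\<^sub>2\<phi>\<^sub>1\<close> form with rescaled arguments and degree \<open>n = r - k\<close>, the only dependence on \<open>r\<close> is
  through the factors \<open>q\<^sup>n - q\<^sup>i\<close>, \<open>i < j\<close>, of the \<open>j\<close>-th term. Their product tends to
  \<open>(-1)^j q^(j(j-1)/2)\<close> and is bounded by \<open>q^(j(j-1)/2)\<close> in absolute value, so the terms are
  dominated by those of the \<open>\<^sub>1\<phi>\<^sub>1\<close> bound and Tannery's theorem applies.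
\<close>

text \<open>Up to sign and a power of q this is the Gaussian binomial coefficient: it equals (-1)^j
  q^(j(j-1)/2 - nj) times [n choose j]_q. Writing q^(-n) as \<open>inverse q ^ n\<close> keeps all
  exponents natural numbers.\<close>

definition qcoeff :: "real \<Rightarrow> nat \<Rightarrow> nat \<Rightarrow> real" where
  "qcoeff q n j = qpoch (inverse q ^ n) q j / qpoch q q j"

section \<open>Elementary facts on q-shifted factorials\<close>

lemma qpoch_0 [simp]: "qpoch a q 0 = 1"
  by (simp add: qpoch_def)

lemma qpoch_Suc: "qpoch a q (Suc n) = qpoch a q n * (1 - a * q ^ n)"
  by (simp add: qpoch_def)

lemma qpoch_Suc_shift: "qpoch a q (Suc n) = (1 - a) * qpoch (a * q) q n"
  by (simp add: qpoch_def prod.lessThan_Suc_shift mult.assoc del: prod.lessThan_Suc)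

lemma qpoch_pos:
  assumes "0 \<le> q" "q \<le> 1" "a < 1"
  shows "0 < qpoch a q n"
  unfolding qpoch_def
proof (intro prod_pos ballI)
  fix i
  have "q ^ i \<le> 1" "0 \<le> q ^ i"
    using assms by (auto intro: power_le_one)
  then have "a * q ^ i < 1"
    using assms by (smt (verit) mult_left_le mult_nonneg_nonneg mult_nonpos_nonneg)
  then show "0 < 1 - a * q ^ i"
    by simp
qed

lemma qpoch_inverse_power_eq_0:
  assumes "q \<noteq> 0" "n < j"
  shows "qpoch (inverse q ^ n) q j = 0"
proof -
  have "1 - inverse q ^ n * q ^ n = 0"
    using assms by (simp flip: power_mult_distrib)
  with \<open>n < j\<close> show ?thesis
    unfolding qpoch_def by (auto simp: prod_zero_iff)
qed

section \<open>Recurrences for the q-binomial coefficients\<close>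

lemma qcoeff_0 [simp]: "qcoeff q n 0 = 1"
  by (simp add: qcoeff_def)

lemma qcoeff_eq_0:
  assumes "q \<noteq> 0" "n < j"
  shows "qcoeff q n j = 0"
  using assms by (simp add: qcoeff_def qpoch_inverse_power_eq_0)

text \<open>The q-analogue of the absorption identity for binomial coefficients: splitting off the
  first numerator factor leaves the numerator of index n, because q^(-n-1) * q = q^(-n).\<close>

lemma qcoeff_Suc_Suc:
  assumes "0 < q"
  shows "qcoeff q (Suc n) (Suc j) = qcoeff q n j * (1 - inverse q ^ Suc n) / (1 - q ^ Suc j)"
proof -
  have "inverse q ^ Suc n * q = inverse q ^ n"
    using assms by simp
  then have "qpoch (inverse q ^ Suc n) q (Suc j) =
      (1 - inverse q ^ Suc n) * qpoch (inverse q ^ n) q j"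
    by (simp only: qpoch_Suc_shift)
  then show ?thesis
    by (simp add: qcoeff_def qpoch_Suc)
qed

text \<open>Both coefficients with lower index \<open>Suc j\<close> are explicit multiples of
  \<open>qcoeff q n j\<close> with denominator 1 - q^(j+1), so the claim is a rational identity in u
  = q^(-n-1) and w = q^(j+1).\<close>

lemma qcoeff_Pascal:
  assumes "0 < q" "q < 1"
  shows "qcoeff q (Suc n) (Suc j) = qcoeff q n (Suc j) - inverse q ^ Suc n * qcoeff q n j"
proof -
  have identity: "t * (1 - u) / (1 - w) = t * (1 - u * w) / (1 - w) - u * t"
    if "1 - w \<noteq> 0" for t u w :: real
    using that by (simp add: field_simps)
  have "q ^ Suc j < 1"
    using assms by (intro power_Suc_less_one)
  moreover have "inverse q ^ Suc n * q ^ Suc j = inverse q ^ n * q ^ j"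
    using assms by simp
  then have "qcoeff q n (Suc j) =
      qcoeff q n j * (1 - inverse q ^ Suc n * q ^ Suc j) / (1 - q ^ Suc j)"
    by (simp add: qcoeff_def qpoch_Suc)
  ultimately show ?thesis
    unfolding qcoeff_Suc_Suc[OF assms(1)] by (simp only:) (intro identity, simp)
qed

text \<open>Pascal's rule summed against an arbitrary f; it drives the inductions for the q-binomial
  and the q-Chu-Vandermonde sums. The first sum on the right absorbs the boundary term f 0, since
  \<open>qcoeff q n (Suc n)\<close> vanishes.\<close>

lemma sum_qcoeff_Suc:
  assumes "0 < q" "q < 1"
  shows "(\<Sum>j\<le>Suc n. qcoeff q (Suc n) j * f j) =
    (\<Sum>j\<le>n. qcoeff q n j * f j) - inverse q ^ Suc n * (\<Sum>j\<le>n. qcoeff q n j * f (Suc j))"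
proof -
  have "(\<Sum>j\<le>Suc n. qcoeff q n j * f j) = (\<Sum>j\<le>n. qcoeff q n j * f j)"
    using assms by (simp add: qcoeff_eq_0)
  then have "(\<Sum>j\<le>n. qcoeff q n j * f j) = f 0 + (\<Sum>j\<le>n. qcoeff q n (Suc j) * f (Suc j))"
    unfolding sum.atMost_Suc_shift by simp
  then show ?thesis
    unfolding sum.atMost_Suc_shift qcoeff_Pascal[OF assms]
    by (simp add: left_diff_distrib sum_subtractf sum_distrib_left mult.assoc)
qed

section \<open>The q-binomial theorem, the q-Chu-Vandermonde sum and the transformation\<close>

lemma q_binomial_sum:
  assumes "0 < q" "q < 1"
  shows "(\<Sum>j\<le>n. qcoeff q n j * z ^ j) = qpoch (z * inverse q ^ n) q n"
proof (induction n)
  case (Suc n)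
  have "z * inverse q ^ Suc n * q = z * inverse q ^ n"
    using assms by simp
  then have "qpoch (z * inverse q ^ Suc n) q (Suc n) =
      (1 - z * inverse q ^ Suc n) * qpoch (z * inverse q ^ n) q n"
    unfolding qpoch_Suc_shift by (simp only:)
  moreover have "(\<Sum>j\<le>n. qcoeff q n j * z ^ Suc j) = z * (\<Sum>j\<le>n. qcoeff q n j * z ^ j)"
    by (simp add: sum_distrib_left mult_ac)
  ultimately show ?case
    unfolding sum_qcoeff_Suc[OF assms] Suc by (simp only: algebra_simps)
qed simp

text \<open>The right-hand product stands for (A/x;q)_j x^j and remains meaningful at x = 0. The
  induction keeps x and A general: shifting the index in the second sum of
  \<open>sum_qcoeff_Suc\<close> pulls out q (1 - x)/(1 - A) and leaves the same sum at x q and A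
  q.\<close>

lemma q_Chu_Vandermonde:
  assumes "0 < q" "q < 1" "A < 1"
  shows "(\<Sum>m\<le>j. qcoeff q j m * (qpoch x q m * q ^ m / qpoch A q m)) =
    (\<Prod>i<j. x - A * q ^ i) / qpoch A q j"
  using assms(3)
proof (induction j arbitrary: x A)
  case (Suc j)
  have Aq: "A * q < 1"
    using Suc.prems assms by (smt (verit) mult_less_cancel_right2 mult_nonpos_nonneg)
  have "(\<Sum>m\<le>j. qcoeff q j m * (qpoch x q (Suc m) * q ^ Suc m / qpoch A q (Suc m))) =
      (1 - x) / (1 - A) * q *
        (\<Sum>m\<le>j. qcoeff q j m * (qpoch (x * q) q m * q ^ m / qpoch (A * q) q m))"
    unfolding sum_distrib_left qpoch_Suc_shift by (intro sum.cong) auto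
  also have "\<dots> = (1 - x) / (1 - A) * q * ((\<Prod>i<j. x * q - A * q * q ^ i) / qpoch (A * q) q j)"
    by (simp only: Suc.IH[OF Aq])
  also have "(\<Prod>i<j. x * q - A * q * q ^ i) = q ^ j * (\<Prod>i<j. x - A * q ^ i)"
    by (induction j) (simp_all add: algebra_simps)
  also have "(1 - x) / (1 - A) * q * (q ^ j * (\<Prod>i<j. x - A * q ^ i) / qpoch (A * q) q j) =
      q ^ Suc j * ((1 - x) * (\<Prod>i<j. x - A * q ^ i) / qpoch A q (Suc j))"
    by (simp add: qpoch_Suc_shift mult_ac)
  moreover have "inverse q ^ Suc j * q ^ Suc j = 1"
    using assms by (simp flip: power_Suc power_mult_distrib)
  ultimately have shifted: "inverse q ^ Suc j *
      (\<Sum>m\<le>j. qcoeff q j m * (qpoch x q (Suc m) * q ^ Suc m / qpoch A q (Suc m))) =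
      (1 - x) * (\<Prod>i<j. x - A * q ^ i) / qpoch A q (Suc j)"
    by (simp only: flip: mult.assoc)
  have "qpoch A q (Suc j) > 0" "qpoch A q j > 0"
    using qpoch_pos Suc.prems assms by auto
  \<comment> \<open>Over the common denominator the two sums combine through (1 - A q^j) - (1 - x) =
    x - A q^j, which is the new factor of the product.\<close>
  then have "(\<Prod>i<j. x - A * q ^ i) / qpoch A q j =
      (1 - A * q ^ j) * (\<Prod>i<j. x - A * q ^ i) / qpoch A q (Suc j)"
    by (auto simp: qpoch_Suc)
  then show ?case
    unfolding sum_qcoeff_Suc[OF assms(1,2)] shifted Suc.IH[OF Suc.prems]
    by (simp add: algebra_simps flip: diff_divide_distrib)
qed simp

text \<open>Absorption lowers n, j and m together while replacing z by z/q, until m = 0, where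
  \<open>q_binomial_sum\<close> applies. Negativity of z survives this replacement and keeps the
  denominators 1 - q/z nonzero.\<close>

lemma sum_qcoeff_qcoeff:
  assumes "0 < q" "q < 1" "z < 0"
  shows "(\<Sum>j\<le>n. qcoeff q n j * qcoeff q j m * z ^ j) =
    qpoch (z * inverse q ^ n) q n * qcoeff q n m / qpoch (q / z) q m"
  using assms(3)
proof (induction n arbitrary: m z)
  case 0
  then show ?case
    using assms by (cases m) (auto simp: qcoeff_eq_0)
next
  case (Suc n)
  show ?case
  proof (cases m)
    case 0
    then show ?thesis
      using q_binomial_sum[OF assms(1,2), of "Suc n" z] by simp
  next
    case (Suc m')
    have zq: "z / q < 0"
      using Suc.prems assms by (simp add: divide_neg_pos)
    \<comment> \<open>Absorption in both coefficients leaves the j-dependent quotient (1 -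
      q^(-j-1))/(1 - q^(j+1)) = -q^(-j-1), which turns z^(j+1) into -(z/q) (z/q)^j. Everything
      independent of j is collected in \<open>K\<close>.\<close>
    define K where "K = - (z / q) * (1 - inverse q ^ Suc n) / (1 - q ^ Suc m')"
    have step: "qcoeff q (Suc n) (Suc j) * qcoeff q (Suc j) (Suc m') * z ^ Suc j =
        K * (qcoeff q n j * qcoeff q j m' * (z / q) ^ j)" for j
    proof -
      have "q ^ Suc j < 1"
        using assms by (intro power_Suc_less_one)
      then have 1: "(1 - inverse q ^ Suc j) / (1 - q ^ Suc j) = - (inverse q ^ Suc j)"
        using assms by (simp add: field_simps)
      have "qcoeff q (Suc n) (Suc j) * qcoeff q (Suc j) (Suc m') =
          qcoeff q n j * qcoeff q j m' * ((1 - inverse q ^ Suc n) / (1 - q ^ Suc m')) *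
            ((1 - inverse q ^ Suc j) / (1 - q ^ Suc j))"
        unfolding qcoeff_Suc_Suc[OF assms(1)]
        by (simp only: times_divide_times_eq times_divide_eq_left times_divide_eq_right
            divide_divide_eq_left mult_ac)
      then show ?thesis
        unfolding 1
        by (simp add: K_def field_simps)
    qed
    have "(\<Sum>j\<le>Suc n. qcoeff q (Suc n) j * qcoeff q j m * z ^ j) =
        K * (\<Sum>j\<le>n. qcoeff q n j * qcoeff q j m' * (z / q) ^ j)"
      unfolding sum.atMost_Suc_shift Suc step
      using assms by (simp add: qcoeff_eq_0 sum_distrib_left)
    also have "\<dots> = K * (qpoch (z / q * inverse q ^ n) q n * qcoeff q n m' / qpoch (q / (z / q)) q m')"
      by (simp only: Suc.IH[OF zq])
    also have "\<dots> = (- (z / q) * qpoch (z * inverse q ^ Suc n) q n) *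
        qcoeff q (Suc n) m / qpoch (q / z * q) q m'"
      unfolding Suc qcoeff_Suc_Suc[OF assms(1)] by (simp add: K_def field_simps)
    also have "- (z / q) * qpoch (z * inverse q ^ Suc n) q n =
        qpoch (z * inverse q ^ Suc n) q (Suc n) / (1 - q / z)"
    proof -
      \<comment> \<open>The last factor of the longer product is 1 - z/q; rewriting it as -(z/q) (1
        - q/z) produces the first factor of (q/z;q)_m.\<close>
      have "1 - z * inverse q ^ Suc n * q ^ n = 1 - z / q"
        using assms by (simp add: field_simps)
      also have "\<dots> = - (z / q) * (1 - q / z)"
        using assms Suc.prems by (simp add: field_simps)
      finally have "qpoch (z * inverse q ^ Suc n) q (Suc n) =
          - (z / q) * qpoch (z * inverse q ^ Suc n) q n * (1 - q / z)"
        by (simp only: qpoch_Suc mult_ac)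
      moreover have "1 - q / z \<noteq> 0"
        using assms Suc.prems by (simp add: field_simps)
      ultimately show ?thesis
        by (simp only: nonzero_mult_div_cancel_right simp_thms)
    qed
    finally show ?thesis
      by (simp add: Suc qpoch_Suc_shift mult_ac)
  qed
qed

text \<open>The normalizing prefactor is exactly the one in \<open>sum_qcoeff_qcoeff\<close> at z =
  -1/c, where q/z = -cq is the lower parameter of the original series. That identity is read from
  right to left to introduce the sum over j; after the exchange the sum over m is of
  q-Chu-Vandermonde type.\<close>

theorem big_q_Jacobi_tilde_eq_phi21:
  assumes "0 < q" "q < 1" "a * q < 1" "c > 0"
  shows "big_q_Jacobi_tilde n x a c q =
    (\<Sum>j\<le>n. qcoeff q n j * ((\<Prod>i<j. x - a * q * q ^ i) / qpoch (a * q) q j) * (- inverse c) ^ j)"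
proof -
  have qn: "q powi (- int n) = inverse q ^ n"
    using assms by (simp add: power_int_minus power_inverse)
  let ?v = "\<lambda>m. qpoch x q m * q ^ m / qpoch (a * q) q m"
  have q0: "qpoch 0 q j = 1" for j
    by (simp add: qpoch_def)
  have "big_q_Jacobi n x a 0 c q = (\<Sum>m. qcoeff q n m * ?v m / qpoch (- c * q) q m)"
    by (simp add: big_q_Jacobi_def phi32_def qn qcoeff_def q0 mult_ac)
  also have "\<dots> = (\<Sum>m\<le>n. qcoeff q n m * ?v m / qpoch (- c * q) q m)"
    using assms by (intro suminf_finite) (auto simp: qcoeff_eq_0)
  finally have "big_q_Jacobi_tilde n x a c q =
      (\<Sum>m\<le>n. qpoch (- inverse c * inverse q ^ n) q n * qcoeff q n m / qpoch (- c * q) q m * ?v m)"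
    unfolding big_q_Jacobi_tilde_def qn by (simp add: sum_distrib_left mult_ac)
  also have "\<dots> = (\<Sum>m\<le>n. (\<Sum>j\<le>n. qcoeff q n j * qcoeff q j m * (- inverse c) ^ j) * ?v m)"
  proof -
    have "q / - inverse c = - c * q"
      by (simp add: divide_inverse)
    moreover have "- inverse c < 0"
      using assms by simp
    ultimately show ?thesis
      using sum_qcoeff_qcoeff[OF assms(1,2), of "- inverse c" n] by (simp only:)
  qed
  also have "\<dots> = (\<Sum>j\<le>n. \<Sum>m\<le>n. qcoeff q n j * (- inverse c) ^ j * (qcoeff q j m * ?v m))"
    unfolding sum_distrib_right by (subst sum.swap) (simp add: mult_ac)
  also have "\<dots> = (\<Sum>j\<le>n. qcoeff q n j * (- inverse c) ^ j * (\<Sum>m\<le>j. qcoeff q j m * ?v m))"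
  proof (rule sum.cong)
    fix j assume "j \<in> {..n}"
    then have "(\<Sum>m\<le>n. qcoeff q j m * ?v m) = (\<Sum>m\<le>j. qcoeff q j m * ?v m)"
      using assms by (intro sum.mono_neutral_right) (auto simp: qcoeff_eq_0)
    then show "(\<Sum>m\<le>n. qcoeff q n j * (- inverse c) ^ j * (qcoeff q j m * ?v m)) =
        qcoeff q n j * (- inverse c) ^ j * (\<Sum>m\<le>j. qcoeff q j m * ?v m)"
      by (simp only: sum_distrib_left[symmetric])
  qed simp
  finally show ?thesis
    using q_Chu_Vandermonde[OF assms(1-3)] by (simp add: mult_ac)
qed

section \<open>Domination of the terms and passage to the limit\<close>

lemma prod_power_eq: "(\<Prod>i<j. q ^ i) = (q :: 'a :: comm_monoid_mult) ^ (j * (j - 1) div 2)"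
  by (simp add: power_sum[symmetric] lessThan_atLeast0 Sum_Ico_nat)

text \<open>For n < j the factor i = n is zero; otherwise 0 \<le> q^i - q^n \<le> q^i for every i <
  j. The bound does not depend on n, as dominated convergence requires.\<close>

lemma abs_prod_power_diff_le:
  assumes "0 < q" "q < (1::real)"
  shows "\<bar>\<Prod>i<j. q ^ n - q ^ i\<bar> \<le> q ^ (j * (j - 1) div 2)"
proof (cases "n < j")
  case True
  then have "(\<Prod>i<j. q ^ n - q ^ i) = 0"
    by (intro prod_zero) auto
  then show ?thesis
    using assms by (simp only:) simp
next
  case False
  have "\<bar>\<Prod>i<j. q ^ n - q ^ i\<bar> \<le> (\<Prod>i<j. q ^ i)"
    unfolding abs_prod
  proof (intro prod_mono conjI abs_ge_zero)
    fix i assume "i \<in> {..<j}"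
    then have "q ^ n \<le> q ^ i" "0 \<le> q ^ n"
      using False assms by (auto intro!: power_decreasing)
    then show "\<bar>q ^ n - q ^ i\<bar> \<le> q ^ i"
      by simp
  qed
  then show ?thesis
    by (simp only: prod_power_eq)
qed

lemma summable_ratio_tendsto_0:
  fixes f :: "nat \<Rightarrow> real"
  assumes "\<And>n. f n > 0" "(\<lambda>n. f (Suc n) / f n) \<longlonglongrightarrow> 0"
  shows "summable f"
proof -
  have "eventually (\<lambda>n. f (Suc n) / f n < 1 / 2) sequentially"
    using assms(2) by (rule order_tendstoD) simp
  then obtain N where N: "f (Suc n) / f n < 1 / 2" if "n \<ge> N" for n
    by (auto simp: eventually_at_top_linorder)
  show ?thesis
  proof (rule summable_ratio_test[of "1 / 2" N])
    fix n assume "N \<le> n"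
    then show "norm (f (Suc n)) \<le> 1 / 2 * norm (f n)"
      using N[of n] assms(1)[of n] assms(1)[of "Suc n"] by (simp add: field_simps)
  qed simp
qed

theorem proposition6p1:
  fixes q \<alpha> c :: real and k :: int
  assumes "0 < q" and "q < 1" and "\<alpha> > -1" and "c > 0"
  shows "(\<forall>x::real.
            ((\<lambda>r::int. big_q_Jacobi_tilde (nat (r - k)) (q powr (\<alpha> + 1) * x) (q powr \<alpha>)
                         (c * q powi (- r - 1)) q)
              \<longlongrightarrow> big_q_Bessel c \<alpha> k x q) at_top)
       \<and> (\<forall>M::real. M > 0 \<longrightarrow>
            (\<forall>x::real. \<forall>r::int. \<bar>x\<bar> \<le> M \<longrightarrow> r \<ge> k \<longrightarrow>
               \<bar>big_q_Jacobi_tilde (nat (r - k)) (q powr (\<alpha> + 1) * x) (q powr \<alpha>)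
                  (c * q powi (- r - 1)) q\<bar>
                 \<le> phi11 (- inverse M) (q powr (\<alpha> + 1)) q
                       (- (q powr (\<alpha> + of_int k + 2)) * M / c)
             \<and> \<bar>big_q_Bessel c \<alpha> k x q\<bar>
                 \<le> phi11 (- inverse M) (q powr (\<alpha> + 1)) q
                       (- (q powr (\<alpha> + of_int k + 2)) * M / c)))"
proof -
  define A where "A = q powr (\<alpha> + 1)"
  \<comment> \<open>Chosen so that the rescaled argument factors as q^(r+1) q^(\<alpha>+1) / c =
    q^(r-k) \<open>K\<close>, which isolates the dependence on r in q^n with n = r - k.\<close>
  define K where "K = q powr (of_int k + \<alpha> + 2) / c"
  have A: "0 < A" "A < 1"
    using assms by (auto simp: A_def powr01_less_one)
  have K: "0 < K"
    using assms by (simp add: K_def)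
  define d where "d j = qpoch A q j * qpoch q q j" for j
  have d: "0 < d j" for j
    using assms A by (auto simp: d_def intro!: mult_pos_pos qpoch_pos)
  \<comment> \<open>\<open>T\<close>, \<open>B\<close> and \<open>D\<close> are the j-th terms of
    the polynomial of index n, of the Bessel series and of the bound. Since \<open>T x n j\<close>
    is 0 for j > n, the polynomial can be treated as an infinite series.\<close>
  define T where "T x n j = (\<Prod>i<j. q ^ n - q ^ i) * (\<Prod>i<j. x - q ^ i) / d j * (- K) ^ j"
    for x :: real and n j
  define B where "B x j = (\<Prod>i<j. x - q ^ i) / d j * (-1) ^ j * q ^ (j * (j - 1) div 2) * (- K) ^ j"
    for x :: real and j
  define D where "D M j = (\<Prod>i<j. M + q ^ i) / d j * q ^ (j * (j - 1) div 2) * K ^ j"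
    for M :: real and j

  have Bessel: "big_q_Bessel c \<alpha> k x q = (\<Sum>j. B x j)" for x
    by (simp add: big_q_Bessel_def B_def d_def A_def K_def field_simps)

  have T_eq_0: "T x n j = 0" if "n < j" for x n j
    using that by (auto simp: T_def prod_zero_iff)

  have Jacobi: "big_q_Jacobi_tilde (nat (r - k)) (q powr (\<alpha> + 1) * x) (q powr \<alpha>)
      (c * q powi (- r - 1)) q = (\<Sum>j. T x (nat (r - k)) j)" if "r \<ge> k" for x r
  proof -
    define n where "n = nat (r - k)"
    have Aq: "q powr \<alpha> * q = A"
      using assms by (simp add: A_def powr_add)
    have "inverse (c * q powi (- r - 1)) * A = q ^ n * K"
    proof -
      have "inverse (q powi (- r - 1)) = q powr (r + 1)"
        using assms powr_real_of_int'[of q "r + 1"] by (simp add: add.commute flip: power_int_minus)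
      then have "inverse (c * q powi (- r - 1)) * A = q powr (r + 1) * q powr (\<alpha> + 1) / c"
        by (simp add: A_def divide_inverse mult_ac)
      moreover have "q ^ n = q powr (of_int (r - k))"
        using assms that by (simp add: n_def powr_realpow[symmetric])
      ultimately show ?thesis
        by (simp add: K_def add_ac flip: powr_add)
    qed
    then have scale: "A ^ j * (- inverse (c * q powi (- r - 1))) ^ j = (q ^ n) ^ j * (- K) ^ j" for j
      by (simp add: mult.commute flip: power_mult_distrib)
    have summand: "qcoeff q n j * ((\<Prod>i<j. A * x - A * q ^ i) / qpoch A q j) *
        (- inverse (c * q powi (- r - 1))) ^ j = T x n j" for j
    proof -
      have 1: "(\<Prod>i<j. A * x - A * q ^ i) = A ^ j * (\<Prod>i<j. x - q ^ i)"
        by (simp add: prod.distrib flip: right_diff_distrib)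
      \<comment> \<open>The power (q^n)^j coming from \<open>scale\<close> is distributed over the j
        factors, where it clears the negative powers of q.\<close>
      have "(q ^ n) ^ j * qpoch (inverse q ^ n) q j = (\<Prod>i<j. q ^ n * (1 - inverse q ^ n * q ^ i))"
        by (simp add: qpoch_def prod.distrib)
      also have "\<dots> = (\<Prod>i<j. q ^ n - q ^ i)"
        using assms by (intro prod.cong) (auto simp: field_simps)
      finally have 2: "(q ^ n) ^ j * qpoch (inverse q ^ n) q j = (\<Prod>i<j. q ^ n - q ^ i)" .
      have "qcoeff q n j * ((\<Prod>i<j. A * x - A * q ^ i) / qpoch A q j) *
          (- inverse (c * q powi (- r - 1))) ^ j =
          qpoch (inverse q ^ n) q j * (\<Prod>i<j. x - q ^ i) / d j *
            (A ^ j * (- inverse (c * q powi (- r - 1))) ^ j)"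
        unfolding 1 by (simp add: qcoeff_def d_def mult_ac)
      also have "\<dots> = T x n j"
        unfolding scale T_def 2[symmetric] by simp
      finally show ?thesis .
    qed
    have "big_q_Jacobi_tilde n (A * x) (q powr \<alpha>) (c * q powi (- r - 1)) q = (\<Sum>j\<le>n. T x n j)"
      using assms A
      by (subst big_q_Jacobi_tilde_eq_phi21) (simp_all only: Aq summand, simp_all)
    also have "\<dots> = (\<Sum>j. T x n j)"
      by (intro suminf_finite[symmetric]) (auto simp: T_eq_0)
    finally show ?thesis
      by (simp add: n_def A_def)
  qed

  have T_le: "\<bar>T x n j\<bar> \<le> D M j" and B_le: "\<bar>B x j\<bar> \<le> D M j" if "\<bar>x\<bar> \<le> M" for x M n j
  proof -
    have x: "\<bar>\<Prod>i<j. x - q ^ i\<bar> \<le> (\<Prod>i<j. M + q ^ i)"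
      unfolding abs_prod
    proof (intro prod_mono conjI abs_ge_zero)
      fix i
      have "0 < q ^ i"
        using assms by simp
      with that show "\<bar>x - q ^ i\<bar> \<le> M + q ^ i"
        by linarith
    qed
    then have "0 \<le> (\<Prod>i<j. M + q ^ i)"
      by (meson abs_ge_zero order_trans)
    have "\<bar>T x n j\<bar> = \<bar>\<Prod>i<j. q ^ n - q ^ i\<bar> * \<bar>\<Prod>i<j. x - q ^ i\<bar> / d j * K ^ j"
      using d[of j] K by (simp add: T_def abs_mult power_abs)
    also have "\<dots> \<le> q ^ (j * (j - 1) div 2) * (\<Prod>i<j. M + q ^ i) / d j * K ^ j"
      using d[of j] K assms x
      by (intro mult_right_mono divide_right_mono mult_mono abs_prod_power_diff_le) auto
    finally show "\<bar>T x n j\<bar> \<le> D M j"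
      by (simp add: D_def mult_ac)
    have "\<bar>B x j\<bar> = \<bar>\<Prod>i<j. x - q ^ i\<bar> / d j * q ^ (j * (j - 1) div 2) * K ^ j"
      using d[of j] K assms by (simp add: B_def abs_mult power_abs)
    also have "\<dots> \<le> D M j"
      unfolding D_def using d[of j] K assms x
      by (intro mult_right_mono divide_right_mono) auto
    finally show "\<bar>B x j\<bar> \<le> D M j" .
  qed

  have summable_D: "summable (D M)" if "M > 0" for M
  proof (rule summable_ratio_tendsto_0)
    show pos: "0 < D M j" for j
      unfolding D_def using d[of j] K assms that
      by (intro mult_pos_pos divide_pos_pos prod_pos) (auto intro: add_pos_pos)
    \<comment> \<open>The quadratic exponent contributes a factor q^j to the ratio, which forces it
      to 0 for every M > 0.\<close>
    have "D M (Suc j) / D M j =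
        (M + q ^ j) * q ^ j * K / ((1 - A * q ^ j) * (1 - q * q ^ j))" for j
    proof -
      have "q ^ (Suc j * (Suc j - 1) div 2) = q ^ (j * (j - 1) div 2) * q ^ j"
        by (simp only: prod_power_eq[symmetric] prod.lessThan_Suc)
      moreover have "d (Suc j) = d j * ((1 - A * q ^ j) * (1 - q * q ^ j))"
        by (simp add: d_def qpoch_Suc)
      ultimately have "D M (Suc j) =
          D M j * ((M + q ^ j) * q ^ j * K / ((1 - A * q ^ j) * (1 - q * q ^ j)))"
        by (simp add: D_def mult_ac)
      then show ?thesis
        using pos[of j] by simp
    qed
    moreover have q: "(\<lambda>j. q ^ j) \<longlonglongrightarrow> 0"
      using assms by (intro LIMSEQ_power_zero) auto
    have "(\<lambda>j. (M + q ^ j) * q ^ j * K / ((1 - A * q ^ j) * (1 - q * q ^ j)))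
        \<longlonglongrightarrow> (M + 0) * 0 * K / ((1 - A * 0) * (1 - q * 0))"
      by (intro tendsto_intros q) auto
    ultimately show "(\<lambda>j. D M (Suc j) / D M j) \<longlonglongrightarrow> 0"
      by simp
  qed

  \<comment> \<open>M^j turns (-1/M;q)_j into the product of the M + q^i, and the sign (-1)^j
    cancels against the negative argument, so all terms are positive.\<close>
  have phi11_D: "phi11 (- inverse M) (q powr (\<alpha> + 1)) q (- (q powr (\<alpha> + of_int k + 2)) * M / c) =
      (\<Sum>j. D M j)" if "M > 0" for M
    unfolding phi11_def
  proof (intro suminf_cong)
    fix j
    have "(\<Prod>i<j. M + q ^ i) = (\<Prod>i<j. M * (1 - - inverse M * q ^ i))"
      using that by (intro prod.cong) (auto simp: field_simps)
    also have "\<dots> = M ^ j * qpoch (- inverse M) q j"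
      by (simp add: qpoch_def prod.distrib)
    finally have 1: "(\<Prod>i<j. M + q ^ i) = M ^ j * qpoch (- inverse M) q j" .
    have "- (q powr (\<alpha> + of_int k + 2)) * M / c = -1 * (M * K)"
      by (simp add: K_def add_ac)
    then have "(-1) ^ j * (- (q powr (\<alpha> + of_int k + 2)) * M / c) ^ j = M ^ j * K ^ j"
      by (simp only: power_mult_distrib flip: mult.assoc) (simp flip: power_mult_distrib)
    then show "qpoch (- inverse M) q j / (qpoch (q powr (\<alpha> + 1)) q j * qpoch q q j) * (-1) ^ j *
        q ^ (j * (j - 1) div 2) * (- (q powr (\<alpha> + of_int k + 2)) * M / c) ^ j = D M j"
      unfolding D_def 1 d_def A_def by (simp add: mult_ac)
  qed

  have n_lim: "filterlim (\<lambda>r. nat (r - k)) at_top at_top"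
    unfolding filterlim_at_top
  proof
    fix N
    show "eventually (\<lambda>r. N \<le> nat (r - k)) at_top"
      using eventually_ge_at_top[of "k + int N"] by eventually_elim simp
  qed

  have limit: "((\<lambda>r. big_q_Jacobi_tilde (nat (r - k)) (q powr (\<alpha> + 1) * x) (q powr \<alpha>)
      (c * q powi (- r - 1)) q) \<longlongrightarrow> big_q_Bessel c \<alpha> k x q) at_top" for x
  proof -
    have "(\<lambda>n. T x n j) \<longlonglongrightarrow> B x j" for j
    proof -
      have q: "(\<lambda>n. q ^ n) \<longlonglongrightarrow> 0"
        using assms by (intro LIMSEQ_power_zero) auto
      have "(\<lambda>n. T x n j) \<longlonglongrightarrow> (\<Prod>i<j. 0 - q ^ i) * (\<Prod>i<j. x - q ^ i) / d j * (- K) ^ j"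
        unfolding T_def using d[of j] by (intro tendsto_intros q) auto
      moreover have "(\<Prod>i<j. 0 - q ^ i) = (-1) ^ j * q ^ (j * (j - 1) div 2)"
        unfolding prod_power_eq[symmetric] by (simp add: prod_uminus)
      ultimately show ?thesis
        by (simp add: B_def mult_ac)
    qed
    \<comment> \<open>The dominating series is taken at |x| + 1 rather than |x| because
      \<open>summable_D\<close> requires a positive parameter and x may be 0.\<close>
    then have "(\<lambda>n. \<Sum>j. T x n j) \<longlonglongrightarrow> (\<Sum>j. B x j)"
      using T_le[of x "\<bar>x\<bar> + 1"] summable_D[of "\<bar>x\<bar> + 1"]
      by (intro tannerys_theorem[where M = "D (\<bar>x\<bar> + 1)", THEN conjunct2, THEN conjunct2])
        (auto intro!: always_eventually)
    \<comment> \<open>\<open>Jacobi\<close> is available only for r \<ge> k, since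
      \<open>nat\<close> truncates negative differences; the two functions of r therefore agree
      eventually, which suffices for the limit.\<close>
    from filterlim_compose[OF this n_lim] show ?thesis
      unfolding Bessel
    proof (rule Lim_transform_eventually)
      show "eventually (\<lambda>r. (\<Sum>j. T x (nat (r - k)) j) =
          big_q_Jacobi_tilde (nat (r - k)) (q powr (\<alpha> + 1) * x) (q powr \<alpha>)
            (c * q powi (- r - 1)) q) at_top"
        using eventually_ge_at_top[of k] by eventually_elim (simp add: Jacobi)
    qed
  qed

  have dominated: "\<bar>\<Sum>j. f j\<bar> \<le> (\<Sum>j. D M j)" if "M > 0" "\<And>j. \<bar>f j\<bar> \<le> D M j" for f M
    using norm_suminf_le[of f "D M"] that summable_D by simp

  show ?thesis
  proof (intro conjI allI impI)
    fix M x :: real and r :: int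
    assume M: "M > 0" "\<bar>x\<bar> \<le> M" and r: "r \<ge> k"
    show "\<bar>big_q_Jacobi_tilde (nat (r - k)) (q powr (\<alpha> + 1) * x) (q powr \<alpha>)
        (c * q powi (- r - 1)) q\<bar>
        \<le> phi11 (- inverse M) (q powr (\<alpha> + 1)) q (- (q powr (\<alpha> + of_int k + 2)) * M / c)"
      unfolding Jacobi[OF r] phi11_D[OF M(1)] using M by (intro dominated T_le)
    show "\<bar>big_q_Bessel c \<alpha> k x q\<bar>
        \<le> phi11 (- inverse M) (q powr (\<alpha> + 1)) q (- (q powr (\<alpha> + of_int k + 2)) * M / c)"
      unfolding Bessel phi11_D[OF M(1)] using M by (intro dominated B_le)
  qed (rule limit)
qed

end
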